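(* Let $d\ge 1$ be an integer and let $A>0$. Put $p_{\mathrm{crit}}=\frac{2(d+2)}{d}$ and $p_{\mathrm{con}}=\frac{2(d+1)}{d}$. For every $\epsilon>0$ there exist $Q_0\ge 1$ and $c_0>0$, depending only on $\epsilon,d,A$, such that for every real-valued $\phi\in C^2([0,1]^d)$ with $\|\phi\|_{C^2}\le A$ and every integer $Q\ge Q_0$ there exist a real-valued $\psi\in C^2([0,1]^d)$ with $\|\phi-\psi\|_{C^2}\le\epsilon$ and a not identically zero sequence $(b_{\mathbf q})_{\mathbf q\in[Q]^d}\subset\mathbb C$ satisfying, for all $1\le p<\infty$, $$\left\| \sup_{t\in[0,Q^2]}\left|\sum_{\mathbf q\in[Q]^d} b_{\mathbf q}\, e\bigl(\mathbf x\cdot\mathbf q/Q+t\psi(\mathbf q/Q)\bigr)\right|\right\|_{L^p_{\mathbf x}([0,Q]^d)}\ \ge\ c_0\, Q^{\frac{d(d+1)}{2(d+2)}+\frac1p}\,\|b\|_{\ell^2}.$$ In particular, the left-hand side with $p=p_{\mathrm{crit}}$ is at least $c_0Q^{\frac d2}\|b\|_{\ell^2}$, and the left-hand side with $p=p_{\mathrm{con}}$ is at least $c_0Q^{\frac d2+\frac{d}{2(d+1)(d+2)}}\|b\|_{\ell^2}$.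
   Context: Notation: $e(z)=e^{2\pi i z}$; $[Q]=\{1,\dots,Q\}$; $\|b\|_{\ell^2}=\bigl(\sum_{\mathbf q\in[Q]^d}|b_{\mathbf q}|^2\bigr)^{1/2}$. The $C^2$ norm is $\|\phi\|_{C^2}=\max_{0\le|\alpha|\le2}\sup_{\xi\in[0,1]^d}|D^\alpha\phi(\xi)|$. *)

theory Defs
  imports "HOL-Analysis.Analysis"
begin

definition p_crit :: "nat \<Rightarrow> real" where
  "p_crit d = 2 * (real d + 2) / real d"

definition p_con :: "nat \<Rightarrow> real" where
  "p_con d = 2 * (real d + 1) / real d"

abbreviation unit_cube :: "(real ^ 'd) set" where
  "unit_cube \<equiv> cbox 0 1"

(* The derivative is taken within S, so it is one-sided on the boundary of S.  When S is a
   nondegenerate closed box, the derivative within S is unique at every point of S. *)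
definition partial_deriv :: "(real ^ 'd) set \<Rightarrow> 'd \<Rightarrow> (real ^ 'd \<Rightarrow> real) \<Rightarrow> real ^ 'd \<Rightarrow> real" where
  "partial_deriv S i f x = frechet_derivative f (at x within S) (axis i 1)"

(* A multi-index alpha is encoded as a word in the coordinates: [] is alpha = 0, [i] is e_i and
   [i, j] is e_i + e_j, so that |alpha| is the length of the word.  For C^2 functions the words
   [i, j] and [j, i] give the same derivative. *)
fun partial_derivs :: "(real ^ 'd) set \<Rightarrow> 'd list \<Rightarrow> (real ^ 'd \<Rightarrow> real) \<Rightarrow> real ^ 'd \<Rightarrow> real" where
  "partial_derivs S [] f = f"
| "partial_derivs S (i # w) f = partial_deriv S i (partial_derivs S w f)"

definition C2_on :: "(real ^ 'd) set \<Rightarrow> (real ^ 'd \<Rightarrow> real) \<Rightarrow> bool" where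
  "C2_on S f \<longleftrightarrow>
     (\<forall>w. length w \<le> 1 \<longrightarrow> partial_derivs S w f differentiable_on S) \<and>
     (\<forall>w. length w = 2 \<longrightarrow> continuous_on S (partial_derivs S w f))"

definition C2_norm :: "(real ^ 'd \<Rightarrow> real) \<Rightarrow> real" where
  "C2_norm f =
     Max ((\<lambda>w. SUP x\<in>unit_cube. \<bar>partial_derivs unit_cube w f x\<bar>) ` {w :: 'd list. length w \<le> 2})"

definition e :: "real \<Rightarrow> complex" where
  "e z = exp (2 * of_real pi * \<i> * of_real z)"

definition grid :: "nat \<Rightarrow> (nat ^ 'd) set" where
  "grid Q = {q. \<forall>i. q $ i \<in> {1..Q}}"

definition grid_point :: "nat \<Rightarrow> nat ^ 'd \<Rightarrow> real ^ 'd" where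
  "grid_point Q q = (\<chi> i. real (q $ i) / real Q)"

definition l2_norm :: "nat \<Rightarrow> (nat ^ 'd \<Rightarrow> complex) \<Rightarrow> real" where
  "l2_norm Q b = L2_set (\<lambda>q. cmod (b q)) (grid Q)"

definition exp_sum ::
  "nat \<Rightarrow> (real ^ 'd \<Rightarrow> real) \<Rightarrow> (nat ^ 'd \<Rightarrow> complex) \<Rightarrow> real ^ 'd \<Rightarrow> real \<Rightarrow> complex" where
  "exp_sum Q \<psi> b x t =
     (\<Sum>q\<in>grid Q. b q * e (x \<bullet> grid_point Q q + t * \<psi> (grid_point Q q)))"

definition maximal_fun ::
  "nat \<Rightarrow> (real ^ 'd \<Rightarrow> real) \<Rightarrow> (nat ^ 'd \<Rightarrow> complex) \<Rightarrow> real ^ 'd \<Rightarrow> real" where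
  "maximal_fun Q \<psi> b x = (SUP t\<in>{0..(real Q)\<^sup>2}. cmod (exp_sum Q \<psi> b x t))"

definition Lp_norm_on :: "real \<Rightarrow> (real ^ 'd) set \<Rightarrow> (real ^ 'd \<Rightarrow> real) \<Rightarrow> real" where
  "Lp_norm_on p S f = (LINT x:S|lborel. \<bar>f x\<bar> powr p) powr (1 / p)"

definition maximal_Lp ::
  "real \<Rightarrow> nat \<Rightarrow> (real ^ 'd \<Rightarrow> real) \<Rightarrow> (nat ^ 'd \<Rightarrow> complex) \<Rightarrow> real" where
  "maximal_Lp p Q \<psi> b = Lp_norm_on p (cbox 0 (\<chi> i. real Q)) (maximal_fun Q \<psi> b)"

end

theory Submission imports Defs begin

text \<open>
  Write d for the dimension and let m be about Q^(1/(d+2)). The coefficients b are the indicator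
  of the coarse sublattice of those q in [Q]^d all of whose coordinates are multiples of m; the
  frequencies q/Q are then h-separated, h = m/Q, and there are N = (Q div m)^d of them, so the l2
  norm of b is sqrt N, while N is the largest value that the exponential sum can take.

  Bumps of width h centred at the frequencies have disjoint supports and C2 norm O(h^(-2)), so any
  values of size at most 1/T, where T is of order h^(-2)/\<epsilon>, can be prescribed for \<phi>
  - \<psi> at the frequencies without its C2 norm exceeding \<epsilon>
  (\<open>small_C2_interpolation\<close>). Hence \<psi> can be chosen so that T \<psi>(q/Q) +
  q_1/Q is an integer for every q in the sublattice.

  At time t = j T the sum therefore agrees with its value at time 0 after a translation of x by j
  in the first coordinate. At time 0 all phases are integers at the points of the lattice (Q/m)
  Z^d, and a displacement by at most 1/(6d) in each coordinate moves every phase by at most 1/6.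
  So the maximal function is at least N/2 on the cubes of side 1/(6d) attached to the points (Q/m)
  l + j e_1, with l in {0,...,m-1}^d and 0 \<le> j < J, where J, of order \<epsilon> m^2, is
  limited by J T \<le> Q^2 (\<open>phase_near_integer\<close>, \<open>cmod_sum_e_ge\<close>). One
  may assume \<epsilon> \<le> 1; then J \<le> m^2 \<le> Q/m, so these cubes are disjoint and lie
  in [0,Q]^d; their total volume is of order J m^d, that is, m^(d+2), up to factors depending on
  \<epsilon> and d, hence comparable to Q. The L^p norm of the maximal function is at least a
  constant times N Q^(1/p), and sqrt N is at least a constant times Q^(d(d+1)/(2(d+2))).
\<close>

section \<open>C2 functions on the unit cube\<close>

text \<open>
  Derivatives within the closed cube are unique even at its boundary, so any derivative that has
  been exhibited there is the one selected in the definition of the partial derivatives.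
\<close>

lemma partial_deriv_unit_cube:
  fixes f :: "real ^ 'd \<Rightarrow> real"
  assumes "x \<in> unit_cube" "(f has_derivative f') (at x within unit_cube)"
  shows "partial_deriv unit_cube i f x = f' (axis i 1)"
proof -
  have "frechet_derivative f (at x within unit_cube) = f'"
    using assms by (intro frechet_derivative_within_cbox) (auto simp: Basis_vec_def inner_axis)
  then show ?thesis by (simp add: partial_deriv_def)
qed

text \<open>
  A function is C2 on the cube, with gradient \<open>g\<close> and Hessian \<open>k\<close>, as soon as the derivatives are
  exhibited there and the Hessian is continuous.
\<close>

lemma partial_derivs_unit_cube:
  fixes f :: "real ^ 'd \<Rightarrow> real"
  assumes f: "\<And>x. x \<in> unit_cube \<Longrightarrow> (f has_derivative f' x) (at x within unit_cube)"
    and f1: "\<And>x i. x \<in> unit_cube \<Longrightarrow> f' x (axis i 1) = g i x"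
    and g: "\<And>x i. x \<in> unit_cube \<Longrightarrow> (g i has_derivative g' i x) (at x within unit_cube)"
    and g1: "\<And>x i j. x \<in> unit_cube \<Longrightarrow> g' i x (axis j 1) = k j i x"
    and k: "\<And>i j. continuous_on unit_cube (k j i)"
  shows "C2_on unit_cube f"
    and "\<And>x i. x \<in> unit_cube \<Longrightarrow> partial_derivs unit_cube [i] f x = g i x"
    and "\<And>x i j. x \<in> unit_cube \<Longrightarrow> partial_derivs unit_cube [j, i] f x = k j i x"
proof -
  show 1: "\<And>x i. x \<in> unit_cube \<Longrightarrow> partial_derivs unit_cube [i] f x = g i x"
    using partial_deriv_unit_cube[OF _ f] f1 by simp
  have d1: "(partial_derivs unit_cube [i] f has_derivative g' i x) (at x within unit_cube)"
    if "x \<in> unit_cube" for x i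
    by (rule has_derivative_transform[OF that 1 g]) (use that in auto)
  show 2: "\<And>x i j. x \<in> unit_cube \<Longrightarrow> partial_derivs unit_cube [j, i] f x = k j i x"
    using partial_deriv_unit_cube[OF _ d1] g1 by simp
  show "C2_on unit_cube f"
    unfolding C2_on_def
  proof (intro conjI allI impI)
    fix w :: "'d list" assume "length w \<le> 1"
    then consider "w = []" | i where "w = [i]" by (cases w) auto
    then show "partial_derivs unit_cube w f differentiable_on unit_cube"
      using f d1 by cases (auto simp: differentiable_on_def differentiable_def)
  next
    fix w :: "'d list" assume "length w = 2"
    then obtain i j where "w = [j, i]" by (auto simp: length_Suc_conv numeral_2_eq_2)
    then show "continuous_on unit_cube (partial_derivs unit_cube w f)"
      using k[of j i] 2 by (metis (no_types, lifting) continuous_on_cong)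
  qed
qed

lemma C2_on_diff:
  fixes f g :: "real ^ 'd \<Rightarrow> real"
  assumes f: "C2_on unit_cube f" and g: "C2_on unit_cube g"
  shows "C2_on unit_cube (\<lambda>x. f x - g x)"
proof -
  let ?D = "\<lambda>f x. frechet_derivative f (at x within unit_cube)"
  have D: "(f has_derivative ?D f x) (at x within unit_cube)"
    "(partial_derivs unit_cube [i] f has_derivative ?D (partial_derivs unit_cube [i] f) x)
       (at x within unit_cube)"
    "continuous_on unit_cube (partial_derivs unit_cube [j, i] f)"
    if "x \<in> unit_cube" "C2_on unit_cube f" for f :: "real ^ 'd \<Rightarrow> real" and x i j
  proof -
    have *: "partial_derivs unit_cube w f differentiable_on unit_cube" if "length w \<le> 1" for w
      using that \<open>C2_on unit_cube f\<close> unfolding C2_on_def by blast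
    show "(f has_derivative ?D f x) (at x within unit_cube)"
      using *[of "[]"] that by (simp add: differentiable_on_def frechet_derivative_works)
    show "(partial_derivs unit_cube [i] f has_derivative ?D (partial_derivs unit_cube [i] f) x)
       (at x within unit_cube)"
      using *[of "[i]"] that by (simp add: differentiable_on_def frechet_derivative_works)
    show "continuous_on unit_cube (partial_derivs unit_cube [j, i] f)"
      using that(2) unfolding C2_on_def by (simp del: partial_derivs.simps)
  qed
  have ne: "(0 :: real ^ 'd) \<in> unit_cube" by (simp add: mem_box_cart)
  show ?thesis
  proof (rule partial_derivs_unit_cube(1))
    fix x :: "real ^ 'd" and i j :: 'd assume x: "x \<in> unit_cube"
    show "((\<lambda>x. f x - g x) has_derivative (\<lambda>v. ?D f x v - ?D g x v)) (at x within unit_cube)"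
      by (intro has_derivative_diff D(1) x f g)
    show "?D f x (axis i 1) - ?D g x (axis i 1) =
        partial_derivs unit_cube [i] f x - partial_derivs unit_cube [i] g x"
      by (simp add: partial_deriv_def)
    show "((\<lambda>x. partial_derivs unit_cube [i] f x - partial_derivs unit_cube [i] g x) has_derivative
        (\<lambda>v. ?D (partial_derivs unit_cube [i] f) x v - ?D (partial_derivs unit_cube [i] g) x v))
        (at x within unit_cube)"
      by (intro has_derivative_diff D(2) x f g)
    show "?D (partial_derivs unit_cube [i] f) x (axis j 1) - ?D (partial_derivs unit_cube [i] g) x (axis j 1)
       = partial_derivs unit_cube [j, i] f x - partial_derivs unit_cube [j, i] g x"
      by (simp add: partial_deriv_def[of _ j])
  next
    fix i j :: 'd
    show "continuous_on unit_cube
       (\<lambda>x. partial_derivs unit_cube [j, i] f x - partial_derivs unit_cube [j, i] g x)"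
      by (intro continuous_on_diff D(3)[OF ne] f g)
  qed
qed

lemma C2_norm_le:
  fixes f :: "real ^ 'd \<Rightarrow> real"
  assumes "\<And>x. x \<in> unit_cube \<Longrightarrow> \<bar>f x\<bar> \<le> B"
    and "\<And>x i. x \<in> unit_cube \<Longrightarrow> \<bar>partial_derivs unit_cube [i] f x\<bar> \<le> B"
    and "\<And>x i j. x \<in> unit_cube \<Longrightarrow> \<bar>partial_derivs unit_cube [j, i] f x\<bar> \<le> B"
  shows "C2_norm f \<le> B"
proof -
  have fin: "finite {w :: 'd list. length w \<le> 2}"
    using finite_lists_length_le[of "UNIV :: 'd set" 2] by simp
  have ne: "(0 :: real ^ 'd) \<in> unit_cube" by (simp add: mem_box_cart)
  have "(SUP x\<in>unit_cube. \<bar>partial_derivs unit_cube w f x\<bar>) \<le> B" if "length w \<le> 2" for w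
  proof (rule cSUP_least)
    consider "w = []" | i where "w = [i]" | i j where "w = [j, i]"
      using \<open>length w \<le> 2\<close>
      by (metis (no_types) One_nat_def Suc_1 le_Suc_eq le_zero_eq length_0_conv length_Suc_conv)
    then show "\<bar>partial_derivs unit_cube w f x\<bar> \<le> B" if "x \<in> unit_cube" for x
      using that assms by cases (auto simp del: partial_derivs.simps(2))
  qed (use ne in blast)
  moreover have "{w :: 'd list. length w \<le> 2} \<noteq> {}" by (auto intro!: exI[of _ "[]"])
  ultimately show ?thesis
    unfolding C2_norm_def using fin by (subst Max_le_iff) auto
qed

section \<open>Interpolation by functions of small C2 norm\<close>

lemma DERIV_max_zero_power:
  fixes u :: real
  assumes "n \<ge> 2"
  shows "((\<lambda>u. max 0 u ^ n) has_real_derivative real n * max 0 u ^ (n - 1)) (at u)"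
proof -
  consider "u > 0" | "u < 0" | "u = 0" by linarith
  then show ?thesis
  proof cases
    case 1
    have "((\<lambda>u. u ^ n) has_real_derivative real n * max 0 u ^ (n - 1)) (at u)"
      using 1 by (auto intro!: derivative_eq_intros)
    then show ?thesis
      by (rule has_field_derivative_transform_within_open[where S = "{0<..}"]) (use 1 in auto)
  next
    case 2
    have "((\<lambda>u. 0) has_real_derivative real n * max 0 u ^ (n - 1)) (at u)"
      using 2 assms by (auto intro!: derivative_eq_intros)
    then show ?thesis
      by (rule has_field_derivative_transform_within_open[where S = "{..<0}"]) (use 2 assms in auto)
  next
    case 3
    have "((\<lambda>x. max 0 x ^ n / x) \<longlongrightarrow> 0) (at (0::real))"
    proof (rule Lim_null_comparison)
      have "((\<lambda>x. \<bar>x\<bar> ^ (n - 1)) \<longlongrightarrow> \<bar>0::real\<bar> ^ (n - 1)) (at 0)"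
        by (intro tendsto_intros)
      then show "((\<lambda>x. \<bar>x\<bar> ^ (n - 1)) \<longlongrightarrow> (0::real)) (at 0)"
        using assms by (simp add: power_0_left)
      have "norm (max 0 x ^ n / x) \<le> \<bar>x\<bar> ^ (n - 1)" if "x \<noteq> 0" for x :: real
      proof -
        obtain k where "n = Suc k" using assms by (cases n) auto
        then show ?thesis using that by (auto simp: max_def abs_mult)
      qed
      then show "\<forall>\<^sub>F x in at 0. norm (max 0 x ^ n / x) \<le> \<bar>x\<bar> ^ (n - 1)"
        by (auto simp: eventually_at intro!: exI[of _ 1])
    qed
    then show ?thesis using 3 assms
      by (simp add: has_field_derivative_iff power_0_left)
  qed
qed

text \<open>
  The bump with centre \<open>c\<close> and width \<open>h\<close> is the cube of the truncated quadratic
  max 0 (1 - 4 |x - c|^2 / h^2).  It equals 1 at \<open>c\<close> and vanishes at distance at least h/2 from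
  \<open>c\<close>; the third power makes it C2 across the boundary of its support.
\<close>

definition bump_arg :: "real \<Rightarrow> real ^ 'd \<Rightarrow> real ^ 'd \<Rightarrow> real" where
  "bump_arg h c x = max 0 (1 - 4 / h\<^sup>2 * ((x - c) \<bullet> (x - c)))"

definition bump :: "real \<Rightarrow> real ^ 'd \<Rightarrow> real ^ 'd \<Rightarrow> real" where
  "bump h c x = bump_arg h c x ^ 3"

text \<open>The first and second partial derivatives of the bump.\<close>

definition bump1 :: "real \<Rightarrow> real ^ 'd \<Rightarrow> 'd \<Rightarrow> real ^ 'd \<Rightarrow> real" where
  "bump1 h c i x = - 24 / h\<^sup>2 * (bump_arg h c x ^ 2 * (x - c) $ i)"

definition bump2 :: "real \<Rightarrow> real ^ 'd \<Rightarrow> 'd \<Rightarrow> 'd \<Rightarrow> real ^ 'd \<Rightarrow> real" where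
  "bump2 h c j i x = - 24 / h\<^sup>2 * (bump_arg h c x ^ 2 * (if i = j then 1 else 0)
     - 16 / h\<^sup>2 * bump_arg h c x * (x - c) $ j * (x - c) $ i)"

lemma bump_arg_power_has_derivative:
  assumes "n \<ge> 2"
  shows "((\<lambda>x. bump_arg h c x ^ n) has_derivative
    (\<lambda>v. real n * bump_arg h c x ^ (n - 1) * (- 8 / h\<^sup>2 * ((x - c) \<bullet> v)))) (at x within S)"
proof -
  have "((\<lambda>x. 1 - k * ((x - c) \<bullet> (x - c))) has_derivative (\<lambda>v. - (2 * k) * ((x - c) \<bullet> v)))
    (at x within S)" for k
    by (auto intro!: derivative_eq_intros simp: inner_commute algebra_simps)
  from this[of "4 / h\<^sup>2"]
  have "((\<lambda>x. 1 - 4 / h\<^sup>2 * ((x - c) \<bullet> (x - c))) has_derivative (\<lambda>v. - 8 / h\<^sup>2 * ((x - c) \<bullet> v)))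
    (at x within S)"
    by simp
  from DERIV_compose_FDERIV[OF DERIV_max_zero_power[OF assms] this] show ?thesis
    unfolding bump_arg_def by (simp add: ac_simps)
qed

lemma bump_has_derivative:
  "(bump h c has_derivative
    (\<lambda>v. 3 * bump_arg h c x ^ 2 * (- 8 / h\<^sup>2 * ((x - c) \<bullet> v)))) (at x within S)"
  using bump_arg_power_has_derivative[of 3 h c x S] by (simp add: bump_def[abs_def])

lemma bump1_has_derivative:
  "(bump1 h c i has_derivative
    (\<lambda>v. - 24 / h\<^sup>2 * (bump_arg h c x ^ 2 * v $ i
       + 2 * bump_arg h c x * (- 8 / h\<^sup>2 * ((x - c) \<bullet> v)) * (x - c) $ i))) (at x within S)"
proof -
  have "((\<lambda>x. (x - c) $ i) has_derivative (\<lambda>v. v $ i)) (at x within S)"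
    by (rule bounded_linear.has_derivative[OF bounded_linear_vec_nth])
      (auto intro!: derivative_eq_intros)
  from has_derivative_mult_right[OF
      has_derivative_mult[OF bump_arg_power_has_derivative[of 2 h c x S] this], of "- 24 / h\<^sup>2"]
  show ?thesis unfolding bump1_def[abs_def] by simp
qed

lemma bump_arg_eq_0:
  assumes "h > 0" "dist x c \<ge> h / 2"
  shows "bump_arg h c x = 0"
proof -
  have "(h/2)\<^sup>2 \<le> (norm (x - c))\<^sup>2" using assms by (intro power_mono) (auto simp: dist_norm)
  then have "1 \<le> 4 / h\<^sup>2 * ((x - c) \<bullet> (x - c))"
    using assms by (simp add: power2_norm_eq_inner[symmetric] field_simps power_divide)
  then show ?thesis by (simp add: bump_arg_def)
qed

lemma bump_arg_le_1: "bump_arg h c x \<le> 1" and bump_arg_ge_0: "bump_arg h c x \<ge> 0"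
  by (auto simp: bump_arg_def)

text \<open>
  On the support the coordinates of \<open>x - c\<close> are at most h/2 in absolute value, so the second
  derivatives are at most 24 (1 + 4) / h^2.  As \<open>h \<le> 1\<close>, this dominates the lower orders as well.
\<close>

lemma bump_bounds:
  fixes c x :: "real ^ 'd"
  assumes h: "0 < h" "h \<le> 1"
  shows "\<bar>bump h c x\<bar> \<le> 120 / h\<^sup>2" "\<bar>bump1 h c i x\<bar> \<le> 120 / h\<^sup>2" "\<bar>bump2 h c j i x\<bar> \<le> 120 / h\<^sup>2"
proof -
  define u where "u = bump_arg h c x"
  have u: "0 \<le> u" "u \<le> 1" by (auto simp: u_def bump_arg_le_1 bump_arg_ge_0)
  have u2: "u\<^sup>2 \<le> 1" using u by (simp add: power_le_one)
  have u3: "\<bar>u ^ 3\<bar> \<le> 1" using u by (simp add: power_le_one)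
  have h2: "h\<^sup>2 \<le> 1" "h\<^sup>2 > 0" using h by (auto simp: power_le_one)
  have "120 / h\<^sup>2 \<ge> 1" using h2 by (simp add: field_simps)
  then show "\<bar>bump h c x\<bar> \<le> 120 / h\<^sup>2" using u3 by (simp add: bump_def u_def)
  have comp: "\<bar>(x - c) $ k\<bar> \<le> h / 2" if "u \<noteq> 0" for k
  proof -
    have "dist x c < h / 2" using bump_arg_eq_0[of h x c] that h by (force simp: u_def)
    then show ?thesis using component_le_norm_cart[of "x - c" k] by (simp add: dist_norm)
  qed
  have "\<bar>u\<^sup>2 * (x - c) $ i\<bar> \<le> 1 / 2"
  proof (cases "u = 0")
    case False
    have "\<bar>u\<^sup>2 * (x - c) $ i\<bar> \<le> 1 * (h / 2)"
      unfolding abs_mult using comp[OF False] u2 by (intro mult_mono) auto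
    then show ?thesis using h by simp
  qed simp
  then have "24 / h\<^sup>2 * \<bar>u\<^sup>2 * (x - c) $ i\<bar> \<le> 24 / h\<^sup>2 * (1 / 2)"
    by (intro mult_left_mono) auto
  moreover have "\<bar>bump1 h c i x\<bar> = 24 / h\<^sup>2 * \<bar>u\<^sup>2 * (x - c) $ i\<bar>"
    by (simp add: bump1_def u_def abs_mult)
  ultimately show "\<bar>bump1 h c i x\<bar> \<le> 120 / h\<^sup>2" using h2 by (simp add: field_simps)
  have 1: "\<bar>16 / h\<^sup>2 * u * (x - c) $ j * (x - c) $ i\<bar> \<le> 4"
  proof (cases "u = 0")
    case False
    have "\<bar>u * ((x - c) $ j * (x - c) $ i)\<bar> \<le> 1 * (h / 2 * (h / 2))"
      unfolding abs_mult using comp[OF False] u h by (intro mult_mono) auto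
    then have "16 / h\<^sup>2 * \<bar>u * ((x - c) $ j * (x - c) $ i)\<bar> \<le> 16 / h\<^sup>2 * (h / 2 * (h / 2))"
      by (intro mult_left_mono) auto
    also have "\<dots> = 4" using h by (simp add: field_simps power2_eq_square)
    also have "16 / h\<^sup>2 * \<bar>u * ((x - c) $ j * (x - c) $ i)\<bar>
        = \<bar>16 / h\<^sup>2 * (u * ((x - c) $ j * (x - c) $ i))\<bar>"
      by (subst abs_mult[of "16 / h\<^sup>2"]) simp
    finally show ?thesis by (simp only: mult.assoc)
  qed simp
  have "\<bar>u\<^sup>2 * (if i = j then 1 else 0) - 16 / h\<^sup>2 * u * (x - c) $ j * (x - c) $ i\<bar> \<le> 1 + 4"
    by (rule order_trans[OF abs_triangle_ineq4 add_mono[OF _ 1]]) (use u2 in auto)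
  then have "24 / h\<^sup>2 * \<bar>u\<^sup>2 * (if i = j then 1 else 0) - 16 / h\<^sup>2 * u * (x - c) $ j * (x - c) $ i\<bar>
      \<le> 24 / h\<^sup>2 * 5"
    by (intro mult_left_mono) auto
  then show "\<bar>bump2 h c j i x\<bar> \<le> 120 / h\<^sup>2"
    unfolding bump2_def u_def[symmetric] by (subst abs_mult) simp
qed

lemma bump_self: "bump h c c = 1"
  by (simp add: bump_def bump_arg_def)

lemma sum_at_most_one_le:
  fixes f :: "'a \<Rightarrow> real"
  assumes "finite G" "B \<ge> 0" "\<And>q. q \<in> G \<Longrightarrow> \<bar>f q\<bar> \<le> B"
    and one: "\<And>q r. q \<in> G \<Longrightarrow> r \<in> G \<Longrightarrow> f q \<noteq> 0 \<Longrightarrow> f r \<noteq> 0 \<Longrightarrow> q = r"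
  shows "\<bar>\<Sum>q\<in>G. f q\<bar> \<le> B"
proof (cases "\<exists>q\<in>G. f q \<noteq> 0")
  case True
  then obtain q where q: "q \<in> G" "f q \<noteq> 0" by blast
  have "(\<Sum>r\<in>G. f r) = (\<Sum>r\<in>{q}. f r)"
    using q one assms(1) by (intro sum.mono_neutral_right) auto
  then show ?thesis using assms(3) q by simp
qed (use assms in simp)

text \<open>
  Values of size at most \<open>M\<close> at h-separated points are interpolated by a function of C2 norm
  O(M / h^2), uniformly in the number of points, because the supports of the bumps are disjoint.
\<close>

lemma small_C2_interpolation:
  fixes c :: "'a \<Rightarrow> real ^ 'd"
  assumes G: "finite G" and h: "0 < h" "h \<le> 1"
    and sep: "\<And>q r. q \<in> G \<Longrightarrow> r \<in> G \<Longrightarrow> q \<noteq> r \<Longrightarrow> dist (c q) (c r) \<ge> h"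
    and a: "\<And>q. q \<in> G \<Longrightarrow> \<bar>a q\<bar> \<le> M" and M: "M \<ge> 0"
  obtains \<eta> :: "real ^ 'd \<Rightarrow> real" where "C2_on unit_cube \<eta>" "C2_norm \<eta> \<le> M * (120 / h\<^sup>2)"
    "\<And>q. q \<in> G \<Longrightarrow> \<eta> (c q) = a q"
proof -
  define \<eta> where "\<eta> = (\<lambda>x. \<Sum>q\<in>G. a q * bump h (c q) x)"
  have one: "q = r"
    if "q \<in> G" "r \<in> G" "bump_arg h (c q) x \<noteq> 0" "bump_arg h (c r) x \<noteq> 0" for q r x
  proof (rule ccontr)
    assume "q \<noteq> r"
    have "dist x (c q) < h / 2" "dist x (c r) < h / 2"
      using that bump_arg_eq_0[OF h(1)] by (meson not_le)+
    then have "dist (c q) (c r) < h"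
      using dist_triangle_half_r by (metis dist_commute)
    then show False using sep[of q r] that \<open>q \<noteq> r\<close> by simp
  qed
  have bound: "\<bar>\<Sum>q\<in>G. a q * F q\<bar> \<le> M * (120 / h\<^sup>2)"
    if "\<And>q. \<bar>F q\<bar> \<le> 120 / h\<^sup>2" "\<And>q. bump_arg h (c q) x = 0 \<Longrightarrow> F q = 0" for F x
  proof (rule sum_at_most_one_le[OF G])
    show "\<bar>a q * F q\<bar> \<le> M * (120 / h\<^sup>2)" if "q \<in> G" for q
      unfolding abs_mult using a[OF that] M \<open>\<bar>F q\<bar> \<le> 120 / h\<^sup>2\<close> by (intro mult_mono) auto
    show "q = r" if "q \<in> G" "r \<in> G" "a q * F q \<noteq> 0" "a r * F r \<noteq> 0" for q r
      using that \<open>\<And>q. bump_arg h (c q) x = 0 \<Longrightarrow> F q = 0\<close> one by (metis mult_zero_right)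
  qed (use M in simp)
  have ax: "(axis j 1 :: real ^ 'd) $ i = (if i = j then 1 else 0)" for i j
    by (simp add: axis_def)
  note P = partial_derivs_unit_cube[of \<eta>
    "\<lambda>x v. \<Sum>q\<in>G. a q * (3 * bump_arg h (c q) x ^ 2 * (- 8 / h\<^sup>2 * ((x - c q) \<bullet> v)))"
    "\<lambda>i x. \<Sum>q\<in>G. a q * bump1 h (c q) i x"
    "\<lambda>i x v. \<Sum>q\<in>G. a q * (- 24 / h\<^sup>2 * (bump_arg h (c q) x ^ 2 * v $ i
       + 2 * bump_arg h (c q) x * (- 8 / h\<^sup>2 * ((x - c q) \<bullet> v)) * (x - c q) $ i))"
    "\<lambda>j i x. \<Sum>q\<in>G. a q * bump2 h (c q) j i x"]
  have 1: "(\<eta> has_derivative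
      (\<lambda>v. \<Sum>q\<in>G. a q * (3 * bump_arg h (c q) x ^ 2 * (- 8 / h\<^sup>2 * ((x - c q) \<bullet> v)))))
      (at x within unit_cube)" for x
    unfolding \<eta>_def by (intro has_derivative_sum has_derivative_mult_right bump_has_derivative)
  have 2: "(\<Sum>q\<in>G. a q * (3 * bump_arg h (c q) x ^ 2 * (- 8 / h\<^sup>2 * ((x - c q) \<bullet> axis i 1))))
      = (\<Sum>q\<in>G. a q * bump1 h (c q) i x)" for x i
    by (intro sum.cong refl) (simp add: bump1_def inner_axis)
  have 3: "((\<lambda>x. \<Sum>q\<in>G. a q * bump1 h (c q) i x) has_derivative
      (\<lambda>v. \<Sum>q\<in>G. a q * (- 24 / h\<^sup>2 * (bump_arg h (c q) x ^ 2 * v $ i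
       + 2 * bump_arg h (c q) x * (- 8 / h\<^sup>2 * ((x - c q) \<bullet> v)) * (x - c q) $ i))))
      (at x within unit_cube)" for x i
    by (intro has_derivative_sum has_derivative_mult_right bump1_has_derivative)
  have 4: "(\<Sum>q\<in>G. a q * (- 24 / h\<^sup>2 * (bump_arg h (c q) x ^ 2 * (axis j 1 :: real ^ 'd) $ i
       + 2 * bump_arg h (c q) x * (- 8 / h\<^sup>2 * ((x - c q) \<bullet> axis j 1)) * (x - c q) $ i)))
      = (\<Sum>q\<in>G. a q * bump2 h (c q) j i x)" for x i j
    by (intro sum.cong refl) (simp add: bump2_def inner_axis ax mult_ac)
  have 5: "continuous_on unit_cube (\<lambda>x. \<Sum>q\<in>G. a q * bump2 h (c q) j i x)" for j i
    unfolding bump2_def bump_arg_def by (intro continuous_intros)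
  note P' = P[OF 1 2 3 4 5]
  show ?thesis
  proof
    show "C2_on unit_cube \<eta>" by (rule P'(1))
    show "C2_norm \<eta> \<le> M * (120 / h\<^sup>2)"
    proof (rule C2_norm_le)
      fix x :: "real ^ 'd" and i j assume x: "x \<in> unit_cube"
      show "\<bar>\<eta> x\<bar> \<le> M * (120 / h\<^sup>2)"
        unfolding \<eta>_def by (intro bound[of _ x] bump_bounds h) (simp add: bump_def)
      show "\<bar>partial_derivs unit_cube [i] \<eta> x\<bar> \<le> M * (120 / h\<^sup>2)"
        unfolding P'(2)[OF x] by (intro bound[of _ x] bump_bounds h) (simp add: bump1_def)
      show "\<bar>partial_derivs unit_cube [j, i] \<eta> x\<bar> \<le> M * (120 / h\<^sup>2)"
        unfolding P'(3)[OF x] by (intro bound[of _ x] bump_bounds h) (simp add: bump2_def)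
    qed
    fix q assume q: "q \<in> G"
    have "\<eta> (c q) = (\<Sum>r\<in>{q}. a r * bump h (c r) (c q))"
      unfolding \<eta>_def
    proof (rule sum.mono_neutral_right[OF G])
      show "\<forall>r\<in>G - {q}. a r * bump h (c r) (c q) = 0"
      proof
        fix r assume r: "r \<in> G - {q}"
        then have "h / 2 \<le> dist (c q) (c r)" using sep[OF q, of r] h by auto
        then have "bump_arg h (c r) (c q) = 0"
          by (rule bump_arg_eq_0[OF h(1)])
        then show "a r * bump h (c r) (c q) = 0" by (simp add: bump_def)
      qed
    qed (use q in auto)
    then show "\<eta> (c q) = a q" by (simp add: bump_self)
  qed
qed

section \<open>Lower bounds for the norm of the maximal function\<close>

text \<open>
  Measurability and boundedness of \<open>f\<close> are needed because the integral of a non-integrable function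
  is 0 by convention.
\<close>

lemma Lp_norm_on_ge:
  fixes f :: "real ^ 'd \<Rightarrow> real"
  assumes p: "p \<ge> 1" and f: "f \<in> borel_measurable borel"
    and S: "S \<in> sets lborel" "emeasure lborel S < \<infinity>" and bd: "\<And>x. \<bar>f x\<bar> \<le> B"
    and E: "E \<in> sets lborel" "E \<subseteq> S" and lam: "lam \<ge> 0" "\<And>x. x \<in> E \<Longrightarrow> lam \<le> f x"
  shows "Lp_norm_on p S f \<ge> lam * measure lborel E powr (1 / p)"
proof -
  have "B \<ge> 0" using bd[of 0] by linarith
  have fm: "f \<in> borel_measurable lborel" using f by simp
  have "set_integrable lborel S (\<lambda>x. \<bar>f x\<bar> powr p)"
    unfolding set_integrable_def
  proof (rule Bochner_Integration.integrable_bound)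
    show "integrable lborel (\<lambda>x. indicator S x *\<^sub>R B powr p)"
      using S by (intro integrable_scaleR_left integrable_real_indicator)
    show "(\<lambda>x. indicat_real S x *\<^sub>R \<bar>f x\<bar> powr p) \<in> borel_measurable lborel"
      using S fm by measurable
    show "AE x in lborel. norm (indicat_real S x *\<^sub>R \<bar>f x\<bar> powr p) \<le> norm (indicat_real S x *\<^sub>R B powr p)"
      using bd p by (auto simp: indicator_def intro!: powr_mono2)
  qed
  moreover have "emeasure lborel E < \<infinity>"
    using emeasure_mono[OF E(2) S(1)] S(2) by (rule le_less_trans)
  ultimately have "(\<integral>x. indicator E x *\<^sub>R lam powr p \<partial>lborel) \<le> (LINT x:S|lborel. \<bar>f x\<bar> powr p)"
    unfolding set_integrable_def set_lebesgue_integral_def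
    using E lam p
    by (intro integral_mono integrable_scaleR_left integrable_real_indicator)
      (auto simp: indicator_def intro!: powr_mono2 order_trans[OF _ abs_ge_self])
  moreover have "(\<integral>x. indicator E x *\<^sub>R lam powr p \<partial>lborel) = lam powr p * measure lborel E"
    using E by simp
  ultimately have le: "lam powr p * measure lborel E \<le> (LINT x:S|lborel. \<bar>f x\<bar> powr p)"
    by (simp add: mult.commute)
  have "lam * measure lborel E powr (1 / p) = (lam powr p * measure lborel E) powr (1 / p)"
    using lam p by (simp add: powr_mult powr_powr)
  also have "\<dots> \<le> Lp_norm_on p S f"
    unfolding Lp_norm_on_def by (intro powr_mono2 le) (use lam p in auto)
  finally show ?thesis .
qed

lemma cmod_e [simp]: "cmod (e z) = 1"
  by (simp add: e_def)

lemma cmod_exp_sum_le: "cmod (exp_sum Q \<psi> b x t) \<le> (\<Sum>q\<in>grid Q. cmod (b q))"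
  unfolding exp_sum_def by (rule order_trans[OF norm_sum]) (simp add: norm_mult)

lemma bdd_above_exp_sum: "bdd_above ((\<lambda>t. cmod (exp_sum Q \<psi> b x t)) ` T)"
  using cmod_exp_sum_le by (rule bdd_aboveI2)

lemma cmod_exp_sum_le_maximal_fun:
  assumes "0 \<le> t" "t \<le> (real Q)\<^sup>2"
  shows "cmod (exp_sum Q \<psi> b x t) \<le> maximal_fun Q \<psi> b x"
  unfolding maximal_fun_def by (rule cSUP_upper[OF _ bdd_above_exp_sum]) (use assms in simp)

lemma abs_maximal_fun_le: "\<bar>maximal_fun Q \<psi> b x\<bar> \<le> (\<Sum>q\<in>grid Q. cmod (b q))"
proof -
  have "0 \<le> cmod (exp_sum Q \<psi> b x 0)" by simp
  also have "\<dots> \<le> maximal_fun Q \<psi> b x" by (rule cmod_exp_sum_le_maximal_fun) auto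
  finally show ?thesis
    unfolding maximal_fun_def
    by (simp add: cSUP_least cmod_exp_sum_le)
qed

text \<open>
  The supremum runs over uncountably many \<open>t\<close>; as each sum is continuous in \<open>x\<close>, the supremum is
  lower semicontinuous, hence Borel.
\<close>

lemma borel_measurable_maximal_fun: "maximal_fun Q \<psi> b \<in> borel_measurable borel"
proof (rule borel_measurableI_greater)
  fix y
  have "{x. y < maximal_fun Q \<psi> b x} = (\<Union>t\<in>{0..(real Q)\<^sup>2}. {x. y < cmod (exp_sum Q \<psi> b x t)})"
    unfolding maximal_fun_def by (auto simp: less_cSUP_iff[OF _ bdd_above_exp_sum])
  also have "open \<dots>"
    unfolding exp_sum_def e_def
    by (intro open_UN ballI open_Collect_less continuous_intros)
  finally show "{x \<in> space borel. y < maximal_fun Q \<psi> b x} \<in> sets borel" by simp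
qed

lemma maximal_Lp_ge:
  fixes E :: "(real ^ 'd) set"
  assumes "p \<ge> 1" "E \<in> sets lborel" "E \<subseteq> cbox 0 (\<chi> i. real Q)" "lam \<ge> 0"
    and "\<And>x. x \<in> E \<Longrightarrow> \<exists>t. 0 \<le> t \<and> t \<le> (real Q)\<^sup>2 \<and> lam \<le> cmod (exp_sum Q \<psi> b x t)"
  shows "maximal_Lp p Q \<psi> b \<ge> lam * measure lborel E powr (1 / p)"
proof -
  have "lam \<le> maximal_fun Q \<psi> b x" if "x \<in> E" for x
    using assms(5)[OF that] cmod_exp_sum_le_maximal_fun by (meson order_trans)
  then show ?thesis
    unfolding maximal_Lp_def
    using assms(1-4) abs_maximal_fun_le[of Q \<psi> b]
    by (intro Lp_norm_on_ge[where B = "\<Sum>q\<in>grid Q. cmod (b q)"] borel_measurable_maximal_fun)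
      (auto simp: emeasure_lborel_cbox_eq)
qed

lemma Re_e_ge_half:
  assumes "\<bar>z - of_int n\<bar> \<le> 1 / 6"
  shows "Re (e z) \<ge> 1 / 2"
proof -
  have "Re (e z) = cos (2 * pi * z)"
    by (simp add: e_def Re_exp)
  also have "2 * pi * z = 2 * pi * (z - of_int n) + 2 * pi * of_int n" by (simp add: algebra_simps)
  also have "cos \<dots> = cos \<bar>2 * pi * (z - of_int n)\<bar>"
    by (simp add: cos_add cos_int_2pin sin_int_2pin)
  also have "\<dots> \<ge> cos (pi / 3)"
  proof (rule cos_monotone_0_pi_le)
    show "\<bar>2 * pi * (z - of_int n)\<bar> \<le> pi / 3"
      using mult_left_mono[OF assms, of "2 * pi"] by (simp add: abs_mult)
  qed auto
  finally show ?thesis by (simp add: cos_60)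
qed

lemma cmod_sum_e_ge:
  assumes "\<And>q. q \<in> G \<Longrightarrow> \<exists>n. \<bar>\<theta> q - of_int n\<bar> \<le> 1 / 6"
  shows "cmod (\<Sum>q\<in>G. e (\<theta> q)) \<ge> real (card G) / 2"
proof -
  have "real (card G) / 2 = (\<Sum>q\<in>G. 1 / 2)" by simp
  also have "\<dots> \<le> (\<Sum>q\<in>G. Re (e (\<theta> q)))"
    using assms Re_e_ge_half by (intro sum_mono) blast
  also have "\<dots> \<le> cmod (\<Sum>q\<in>G. e (\<theta> q))"
    using complex_Re_le_cmod[of "\<Sum>q\<in>G. e (\<theta> q)"] by simp
  finally show ?thesis .
qed

lemma vec_set_eq_image: "{v :: 'a ^ 'd. \<forall>i. v $ i \<in> S} = vec_lambda ` (PiE UNIV (\<lambda>_. S))"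
proof safe
  fix v :: "'a ^ 'd" assume "\<forall>i. v $ i \<in> S"
  then show "v \<in> vec_lambda ` (PiE UNIV (\<lambda>_. S))"
    by (intro image_eqI[of _ _ "vec_nth v"]) auto
qed (auto simp: PiE_iff)

lemma finite_vec_set: "finite S \<Longrightarrow> finite {v :: 'a ^ 'd. \<forall>i. v $ i \<in> S}"
  unfolding vec_set_eq_image by (intro finite_imageI finite_PiE) auto

lemma card_vec_set: "card {v :: 'a ^ 'd. \<forall>i. v $ i \<in> S} = card S ^ CARD('d)"
proof -
  have "inj_on vec_lambda (PiE (UNIV :: 'd set) (\<lambda>_. S))"
    by (rule inj_onI) (simp add: vec_lambda_inject)
  then show ?thesis
    unfolding vec_set_eq_image by (simp add: card_image card_PiE)
qed

lemma measure_Union_separated_cubes: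
  fixes c :: "'a \<Rightarrow> real ^ 'd"
  assumes "finite L" "\<delta> \<ge> 0"
    and sep: "\<And>a b. a \<in> L \<Longrightarrow> b \<in> L \<Longrightarrow> a \<noteq> b \<Longrightarrow> \<exists>i. \<bar>c a $ i - c b $ i\<bar> > \<delta>"
  shows "measure lborel (\<Union>a\<in>L. cbox (c a) (c a + (\<chi> i. \<delta>))) = real (card L) * \<delta> ^ CARD('d)"
proof -
  have "disjoint_family_on (\<lambda>a. cbox (c a) (c a + (\<chi> i. \<delta>))) L"
    unfolding disjoint_family_on_def
  proof (intro ballI impI, rule ccontr)
    fix a b assume *: "a \<in> L" "b \<in> L" "a \<noteq> b"
      "cbox (c a) (c a + (\<chi> i. \<delta>)) \<inter> cbox (c b) (c b + (\<chi> i. \<delta>)) \<noteq> {}"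
    then obtain x where x: "x \<in> cbox (c a) (c a + (\<chi> i. \<delta>))" "x \<in> cbox (c b) (c b + (\<chi> i. \<delta>))"
      by blast
    obtain i where "\<bar>c a $ i - c b $ i\<bar> > \<delta>" using sep * by blast
    moreover have "c a $ i \<le> x $ i \<and> x $ i \<le> c a $ i + \<delta>" "c b $ i \<le> x $ i \<and> x $ i \<le> c b $ i + \<delta>"
      using x by (auto simp: mem_box_cart)
    ultimately show False by linarith
  qed
  then have "measure lborel (\<Union>a\<in>L. cbox (c a) (c a + (\<chi> i. \<delta>)))
      = (\<Sum>a\<in>L. measure lborel (cbox (c a) (c a + (\<chi> i. \<delta>))))"
    using assms(1) by (intro measure_finite_Union) (auto simp: emeasure_lborel_cbox_eq)
  also have "\<dots> = (\<Sum>a\<in>L. \<delta> ^ CARD('d))"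
  proof (rule sum.cong[OF refl])
    fix a
    have "c a \<in> cbox (c a) (c a + (\<chi> i. \<delta>))" using assms(2) by (simp add: mem_box_cart)
    then show "measure lborel (cbox (c a) (c a + (\<chi> i. \<delta>))) = \<delta> ^ CARD('d)"
      by (subst content_cbox_cart) auto
  qed
  finally show ?thesis by simp
qed

lemma card_multiples:
  assumes "m \<ge> (1::nat)"
  shows "card {x\<in>{1..Q}. m dvd x} = Q div m"
proof -
  have "{x\<in>{1..Q}. m dvd x} = (\<lambda>k. m * k) ` {1..Q div m}"
    using assms by (auto simp: less_eq_div_iff_mult_less_eq mult.commute elim!: dvdE)
  moreover have "inj_on (\<lambda>k. m * k) {1..Q div m}" using assms by (auto simp: inj_on_def)
  ultimately show ?thesis by (simp add: card_image)
qed

section \<open>Focusing cubes for a sparse grid of frequencies\<close>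

text \<open>The grid points all of whose coordinates are multiples of \<open>m\<close>.\<close>

definition sparse_grid :: "nat \<Rightarrow> nat \<Rightarrow> (nat ^ 'd) set" where
  "sparse_grid m Q = {q. \<forall>i. q $ i \<in> {x\<in>{1..Q}. m dvd x}}"

lemma finite_grid: "finite (grid Q :: (nat ^ 'd) set)"
  unfolding grid_def by (rule finite_vec_set) simp

lemma sparse_grid_subset: "sparse_grid m Q \<subseteq> grid Q"
  by (auto simp: sparse_grid_def grid_def)

lemma finite_sparse_grid: "finite (sparse_grid m Q :: (nat ^ 'd) set)"
  using finite_subset[OF sparse_grid_subset finite_grid] .

lemma card_sparse_grid: "m \<ge> 1 \<Longrightarrow> card (sparse_grid m Q :: (nat ^ 'd) set) = (Q div m) ^ CARD('d)"
  unfolding sparse_grid_def card_vec_set by (simp only: card_multiples)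

lemma sparse_grid_separated:
  fixes q r :: "nat ^ 'd"
  assumes "q \<in> sparse_grid m Q" "r \<in> sparse_grid m Q" "q \<noteq> r" "Q \<ge> 1"
  shows "dist (grid_point Q q) (grid_point Q r) \<ge> real m / real Q"
proof -
  obtain i where i: "q $ i \<noteq> r $ i" using assms(3) by (auto simp: vec_eq_iff)
  have "int m dvd int (q $ i) - int (r $ i)" using assms by (auto simp: sparse_grid_def)
  then have "int m \<le> \<bar>int (q $ i) - int (r $ i)\<bar>"
    using i by (intro zdvd_imp_le) auto
  then have "real m \<le> \<bar>real (q $ i) - real (r $ i)\<bar>" by linarith
  then have "real m / real Q \<le> \<bar>real (q $ i) - real (r $ i)\<bar> / real Q" by (simp add: divide_right_mono)
  also have "\<dots> = \<bar>(grid_point Q q - grid_point Q r) $ i\<bar>"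
    by (simp add: grid_point_def diff_divide_distrib[symmetric])
  also have "\<dots> \<le> dist (grid_point Q q) (grid_point Q r)"
    unfolding dist_norm by (rule component_le_norm_cart)
  finally show ?thesis .
qed

text \<open>
  The points \<open>R l + j e\<close>, where \<open>e\<close> is the unit vector in the direction \<open>i0\<close>.  With \<open>R = Q / m\<close>,
  the sum over the sparse grid focuses near such a point at the \<open>j\<close>-th focusing time.
\<close>

definition focus_point :: "'d \<Rightarrow> real \<Rightarrow> nat \<times> (nat ^ 'd) \<Rightarrow> real ^ 'd" where
  "focus_point i0 R = (\<lambda>(j, l). \<chi> i. R * real (l $ i) + (if i = i0 then real j else 0))"

text \<open>The admissible pairs \<open>(j, l)\<close>: \<open>j < J\<close>, and every coordinate of \<open>l\<close> is less than \<open>m\<close>.\<close>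

definition focus_index :: "nat \<Rightarrow> nat \<Rightarrow> (nat \<times> (nat ^ 'd)) set" where
  "focus_index m J = {..<J} \<times> {l. \<forall>i. l $ i \<in> {..<m}}"

lemma finite_focus_index: "finite (focus_index m J :: (nat \<times> (nat ^ 'd)) set)"
  unfolding focus_index_def by (intro finite_cartesian_product finite_vec_set) auto

lemma card_focus_index: "card (focus_index m J :: (nat \<times> (nat ^ 'd)) set) = J * m ^ CARD('d)"
  unfolding focus_index_def by (simp only: card_cartesian_product card_vec_set card_lessThan)

text \<open>
  Translates of one point of the lattice of mesh \<open>R\<close> are at integer distances.  Translates of
  different lattice points stay at distance at least 1, since two values of \<open>j\<close> differ by at most
  \<open>J - 1 \<le> R - 1\<close>.
\<close>

lemma focus_point_separated:
  fixes a b :: "nat \<times> (nat ^ 'd)"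
  assumes ab: "a \<in> focus_index m J" "b \<in> focus_index m J" "a \<noteq> b"
    and R: "real J \<le> R" "R \<ge> 1" and \<delta>: "\<delta> < 1"
  shows "\<exists>i. \<bar>focus_point i0 R a $ i - focus_point i0 R b $ i\<bar> > \<delta>"
proof -
  obtain j l where a: "a = (j, l)" by (cases a)
  obtain j' l' where b: "b = (j', l')" by (cases b)
  have j: "j < J" "j' < J" using ab a b by (auto simp: focus_index_def)
  show ?thesis
  proof (cases "l = l'")
    case True
    then have "j \<noteq> j'" using ab a b by simp
    then have "\<bar>real j - real j'\<bar> \<ge> 1" by linarith
    then have "\<bar>focus_point i0 R a $ i0 - focus_point i0 R b $ i0\<bar> \<ge> 1"
      using True by (simp add: a b focus_point_def)
    then show ?thesis using \<delta> by (intro exI[of _ i0]) linarith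
  next
    case False
    then obtain i where "l $ i \<noteq> l' $ i" by (auto simp: vec_eq_iff)
    then have "1 \<le> \<bar>real (l $ i) - real (l' $ i)\<bar>" by linarith
    then have "R \<le> \<bar>R * (real (l $ i) - real (l' $ i))\<bar>"
      using R by (simp add: abs_mult)
    moreover have "\<bar>real j - real j'\<bar> \<le> real J - 1" using j by linarith
    moreover have "focus_point i0 R a $ i - focus_point i0 R b $ i
        = R * (real (l $ i) - real (l' $ i)) + (if i = i0 then real j - real j' else 0)"
      by (simp add: a b focus_point_def algebra_simps)
    ultimately have "\<bar>focus_point i0 R a $ i - focus_point i0 R b $ i\<bar> \<ge> 1"
      using R by (auto split: if_splits)
    then show ?thesis using \<delta> by (intro exI[of _ i]) linarith
  qed
qed

lemma focus_cube_subset: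
  fixes a :: "nat \<times> (nat ^ 'd)"
  assumes a: "a \<in> focus_index m J" and R: "R * real m = real Q" "real J \<le> R" "R \<ge> 1"
    and \<delta>: "0 \<le> \<delta>" "\<delta> \<le> 1"
  shows "cbox (focus_point i0 R a) (focus_point i0 R a + (\<chi> i. \<delta>)) \<subseteq> cbox 0 (\<chi> i. real Q)"
proof -
  obtain j l where al: "a = (j, l)" by (cases a)
  have j: "j < J" and l: "\<And>i. l $ i < m" using a al by (auto simp: focus_index_def)
  have "0 \<le> focus_point i0 R a $ i \<and> focus_point i0 R a $ i + \<delta> \<le> real Q" for i
  proof
    show "0 \<le> focus_point i0 R a $ i" using R by (simp add: al focus_point_def)
    have "R * real (l $ i) \<le> R * (real m - 1)"
      using l[of i] R by (intro mult_left_mono) linarith+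
    also have "\<dots> = real Q - R" using R by (simp add: algebra_simps)
    finally have "R * real (l $ i) \<le> real Q - R" .
    moreover have "(if i = i0 then real j else 0) + \<delta> \<le> R"
      using j R \<delta> by (auto; linarith)
    ultimately show "focus_point i0 R a $ i + \<delta> \<le> real Q" by (simp add: al focus_point_def)
  qed
  then have *: "0 \<le> focus_point i0 R a $ i" "focus_point i0 R a $ i + \<delta> \<le> real Q" for i
    by blast+
  show ?thesis
  proof
    fix x assume "x \<in> cbox (focus_point i0 R a) (focus_point i0 R a + (\<chi> i. \<delta>))"
    then have "focus_point i0 R a $ i \<le> x $ i" "x $ i \<le> focus_point i0 R a $ i + \<delta>" for i
      by (auto simp: mem_box_cart)
    then show "x \<in> cbox 0 (\<chi> i. real Q)"
      using * unfolding mem_box_cart by simp (meson order_trans)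
  qed
qed

text \<open>
  The coherence of the sum: if \<open>T * \<psi>\<close> equals minus the phase of the unit translation in the
  direction \<open>i0\<close> modulo 1 at a frequency \<open>q / Q\<close>, then at time \<open>j * T\<close> the phase of \<open>q\<close> is nearly
  an integer throughout the focusing cube of \<open>(j, l)\<close>.
\<close>

lemma phase_near_integer:
  fixes q :: "nat ^ 'd" and l :: "nat ^ 'd"
  assumes q: "q \<in> sparse_grid m Q" and m: "m \<ge> 1" and Q: "Q \<ge> 1"
    and x: "x \<in> cbox (focus_point i0 (real Q / real m) (j, l))
      (focus_point i0 (real Q / real m) (j, l) + (\<chi> i. \<delta>))"
    and \<delta>: "real CARD('d) * \<delta> \<le> 1 / 6"
    and z: "T * \<psi> (grid_point Q q) + real (q $ i0) / real Q = of_int z"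
  shows "\<exists>n. \<bar>x \<bullet> grid_point Q q + real j * T * \<psi> (grid_point Q q) - of_int n\<bar> \<le> 1 / 6"
proof -
  let ?R = "real Q / real m"
  \<comment> \<open>The only part of the phase that is not an integer comes from the offset \<open>r\<close> within the cube.\<close>
  define r where "r = (\<lambda>i. x $ i - focus_point i0 ?R (j, l) $ i)"
  define n where "n = (\<Sum>i\<in>UNIV. int (l $ i * (q $ i div m))) + int j * z"
  have r: "0 \<le> r i" "r i \<le> \<delta>" for i
    using x by (auto simp: r_def mem_box_cart le_diff_eq diff_le_eq add.commute)
  have q1: "0 \<le> real (q $ i) / real Q" "real (q $ i) / real Q \<le> 1" for i
    using q Q by (auto simp: sparse_grid_def)
  have "\<delta> \<ge> 0" using r order_trans by blast
  have qm: "real (q $ i div m) = real (q $ i) / real m" for i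
    using q by (intro real_of_nat_div) (auto simp: sparse_grid_def)
  have "x $ i * (real (q $ i) / real Q) = real (l $ i * (q $ i div m))
      + (if i = i0 then real j * (real (q $ i0) / real Q) else 0) + r i * (real (q $ i) / real Q)" for i
  proof -
    have "x $ i = ?R * real (l $ i) + (if i = i0 then real j else 0) + r i"
      by (simp add: r_def focus_point_def)
    moreover have "?R * real (l $ i) * (real (q $ i) / real Q) = real (l $ i * (q $ i div m))"
      using Q m by (simp add: qm field_simps)
    ultimately show ?thesis 
      by (cases "i = i0") (simp_all only: distrib_right if_True if_False mult_zero_left simp_thms)
  qed
  then have "x \<bullet> grid_point Q q = real (\<Sum>i\<in>UNIV. l $ i * (q $ i div m))
      + real j * (real (q $ i0) / real Q) + (\<Sum>i\<in>UNIV. r i * (real (q $ i) / real Q))"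
    by (simp add: inner_vec_def grid_point_def sum.distrib)
  moreover have "of_int n = real (\<Sum>i\<in>UNIV. l $ i * (q $ i div m))
      + real j * (T * \<psi> (grid_point Q q) + real (q $ i0) / real Q)"
    unfolding n_def z by simp
  ultimately have eq: "x \<bullet> grid_point Q q + real j * T * \<psi> (grid_point Q q) - of_int n
      = (\<Sum>i\<in>UNIV. r i * (real (q $ i) / real Q))"
    by (simp add: algebra_simps)
  have "0 \<le> (\<Sum>i\<in>UNIV. r i * (real (q $ i) / real Q))"
    using r q1 by (intro sum_nonneg mult_nonneg_nonneg)
  moreover have "(\<Sum>i\<in>UNIV. r i * (real (q $ i) / real Q)) \<le> (\<Sum>i\<in>(UNIV::'d set). \<delta> * 1)"
    using r q1 \<open>\<delta> \<ge> 0\<close> by (intro sum_mono mult_mono)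
  ultimately show ?thesis using \<delta> eq by (intro exI[of _ n]) simp
qed

text \<open>
  The construction at a given scale \<open>m\<close> with \<open>J\<close> focusing times.  The first condition on \<open>J\<close>
  ensures that the focusing cubes are disjoint and contained in the domain of integration, the
  second one that all focusing times are at most \<open>Q\<^sup>2\<close>.
\<close>

lemma focusing_at_scale:
  fixes \<phi> :: "real ^ 'd \<Rightarrow> real"
  assumes \<phi>: "C2_on unit_cube \<phi>" and \<epsilon>: "\<epsilon> > 0"
    and m: "1 \<le> m" "m \<le> Q" and J: "J * m \<le> Q" "real J * 120 \<le> \<epsilon> * (real m)\<^sup>2"
  obtains \<psi> :: "real ^ 'd \<Rightarrow> real" and b :: "nat ^ 'd \<Rightarrow> complex"
  where "C2_on unit_cube \<psi>" "C2_norm (\<lambda>\<xi>. \<phi> \<xi> - \<psi> \<xi>) \<le> \<epsilon>" "\<exists>q\<in>grid Q. b q \<noteq> 0"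
    "l2_norm Q b = sqrt (real ((Q div m) ^ CARD('d)))"
    "\<forall>p\<ge>1. maximal_Lp p Q \<psi> b \<ge> real ((Q div m) ^ CARD('d)) / 2 *
       (real (J * m ^ CARD('d)) * (1 / (6 * real CARD('d))) ^ CARD('d)) powr (1 / p)"
proof -
  fix i0 :: 'd
  define d where "d = real CARD('d)"
  have d: "d \<ge> 1" unfolding d_def using zero_less_card_finite[where 'a='d] by linarith
  define \<delta> where "\<delta> = 1 / (6 * d)"
  have \<delta>: "0 < \<delta>" "\<delta> < 1" "d * \<delta> \<le> 1 / 6" using d by (auto simp: \<delta>_def field_simps)
  define h where "h = real m / real Q"
  define R where "R = real Q / real m"
  have Q: "Q \<ge> 1" using m by simp
  have h: "0 < h" "h \<le> 1" using m by (auto simp: h_def)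
  have "real (J * m) \<le> real Q" using J(1) by (simp only: of_nat_le_iff)
  then have R: "R \<ge> 1" "R * real m = real Q" "real J \<le> R"
    using m by (auto simp: R_def field_simps)
  \<comment> \<open>The shortest time for which prescribing \<open>T * \<psi>\<close> modulo 1 costs at most \<open>\<epsilon>\<close> in C2 norm.\<close>
  define T where "T = 120 / (\<epsilon> * h\<^sup>2)"
  have T: "T > 0" using \<epsilon> h by (simp add: T_def)
  have JT: "real J * T \<le> (real Q)\<^sup>2"
  proof -
    have "real J * T = real J * 120 * ((real Q)\<^sup>2 / (\<epsilon> * (real m)\<^sup>2))"
      by (simp add: T_def h_def power_divide)
    also have "\<dots> \<le> (\<epsilon> * (real m)\<^sup>2) * ((real Q)\<^sup>2 / (\<epsilon> * (real m)\<^sup>2))"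
      using J(2) \<epsilon> by (intro mult_right_mono) auto
    finally show ?thesis using \<epsilon> m by simp
  qed
  define G where "G = (sparse_grid m Q :: (nat ^ 'd) set)"
  have G: "finite G" "G \<subseteq> grid Q" "card G = (Q div m) ^ CARD('d)"
    using m by (auto simp: G_def finite_sparse_grid card_sparse_grid dest: subsetD[OF sparse_grid_subset])
  define w where "w = (\<lambda>q :: nat ^ 'd. T * \<phi> (grid_point Q q) + real (q $ i0) / real Q)"
  \<comment> \<open>Subtracting \<open>frac (w q) / T\<close> from \<open>\<phi>\<close> at the frequency of \<open>q\<close> rounds \<open>w q\<close> down to an integer.\<close>
  obtain \<eta> :: "real ^ 'd \<Rightarrow> real" where \<eta>: "C2_on unit_cube \<eta>"
    "C2_norm \<eta> \<le> (1 / T) * (120 / h\<^sup>2)" "\<And>q. q \<in> G \<Longrightarrow> \<eta> (grid_point Q q) = frac (w q) / T"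
  proof (rule small_C2_interpolation[OF G(1) h, of "grid_point Q" "\<lambda>q. frac (w q) / T" "1 / T"])
    show "h \<le> dist (grid_point Q q) (grid_point Q r)" if "q \<in> G" "r \<in> G" "q \<noteq> r" for q r
      using sparse_grid_separated[of q m Q r] that Q by (simp add: G_def h_def)
    show "\<bar>frac (w q) / T\<bar> \<le> 1 / T" for q
      using T frac_ge_0[of "w q"] frac_lt_1[of "w q"] by (simp add: divide_right_mono abs_div_pos[symmetric])
  qed (use T in auto)
  define \<psi> where "\<psi> = (\<lambda>\<xi>. \<phi> \<xi> - \<eta> \<xi>)"
  define b where "b = (\<lambda>q. if q \<in> G then 1 else (0::complex))"
  define E where "E = (\<Union>a\<in>focus_index m J. cbox (focus_point i0 R a) (focus_point i0 R a + (\<chi> i. \<delta>)))"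
  have int: "T * \<psi> (grid_point Q q) + real (q $ i0) / real Q = of_int \<lfloor>w q\<rfloor>" if "q \<in> G" for q
  proof -
    have "T * \<psi> (grid_point Q q) + real (q $ i0) / real Q = w q - frac (w q)"
      using T \<eta>(3)[OF that] by (simp add: \<psi>_def w_def right_diff_distrib)
    then show ?thesis by (simp add: frac_def)
  qed
  have sum_b: "(\<Sum>q\<in>grid Q. b q * F q) = (\<Sum>q\<in>G. F q)" for F
  proof -
    have "(\<Sum>q\<in>grid Q. b q * F q) = (\<Sum>q\<in>G. b q * F q)"
      using G finite_grid by (intro sum.mono_neutral_right) (auto simp: b_def)
    then show ?thesis by (simp add: b_def)
  qed
  show ?thesis
  proof
    show "C2_on unit_cube \<psi>" unfolding \<psi>_def by (intro C2_on_diff \<phi> \<eta>)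
    show "C2_norm (\<lambda>\<xi>. \<phi> \<xi> - \<psi> \<xi>) \<le> \<epsilon>"
      using \<eta>(2) h \<epsilon> by (simp add: \<psi>_def T_def)
    have "Q div m > 0" using m by (simp add: div_greater_zero_iff)
    then have "G \<noteq> {}" using G by (metis card.empty power_not_zero less_irrefl)
    then show "\<exists>q\<in>grid Q. b q \<noteq> 0" using G by (auto simp: b_def)
    have "(\<Sum>q\<in>grid Q. (cmod (b q))\<^sup>2) = (\<Sum>q\<in>G. 1)"
      using G finite_grid by (intro sum.mono_neutral_cong_right) (auto simp: b_def)
    then show "l2_norm Q b = sqrt (real ((Q div m) ^ CARD('d)))"
      using G by (simp add: l2_norm_def L2_set_def)
    show "\<forall>p\<ge>1. maximal_Lp p Q \<psi> b \<ge> real ((Q div m) ^ CARD('d)) / 2 *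
       (real (J * m ^ CARD('d)) * (1 / (6 * real CARD('d))) ^ CARD('d)) powr (1 / p)"
    proof (intro allI impI)
      fix p :: real assume p: "p \<ge> 1"
      have "measure lborel E = real (J * m ^ CARD('d)) * \<delta> ^ CARD('d)"
        unfolding E_def
        using focus_point_separated[OF _ _ _ R(3) R(1) \<delta>(2), where 'd='d] \<delta>
        by (subst measure_Union_separated_cubes) (auto simp: finite_focus_index card_focus_index)
      moreover have "maximal_Lp p Q \<psi> b \<ge> real (card G) / 2 * measure lborel E powr (1 / p)"
      proof (rule maximal_Lp_ge[OF p])
        show "E \<in> sets lborel" unfolding E_def using finite_focus_index by auto
        show "E \<subseteq> cbox 0 (\<chi> i. real Q)"
          unfolding E_def
          by (intro UN_least focus_cube_subset[OF _ R(2,3,1) less_imp_le[OF \<delta>(1)] less_imp_le[OF \<delta>(2)]])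
        fix x assume "x \<in> E"
        then obtain j l where jl: "(j, l) \<in> focus_index m J"
          "x \<in> cbox (focus_point i0 R (j, l)) (focus_point i0 R (j, l) + (\<chi> i. \<delta>))"
          unfolding E_def by auto
        have "real j * T \<le> real J * T" using jl T by (intro mult_right_mono) (auto simp: focus_index_def)
        then have "real j * T \<le> (real Q)\<^sup>2" using JT by linarith
        moreover have "real (card G) / 2
            \<le> cmod (\<Sum>q\<in>G. e (x \<bullet> grid_point Q q + real j * T * \<psi> (grid_point Q q)))"
          using phase_near_integer[where T = T and \<psi> = \<psi>, OF _ m(1) Q jl(2)[unfolded R_def] \<delta>(3)[unfolded d_def] int]
          by (intro cmod_sum_e_ge) (auto simp: G_def)
        moreover have "exp_sum Q \<psi> b x (real j * T)
            = (\<Sum>q\<in>G. e (x \<bullet> grid_point Q q + real j * T * \<psi> (grid_point Q q)))"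
          unfolding exp_sum_def by (rule sum_b)
        ultimately show "\<exists>t\<ge>0. t \<le> (real Q)\<^sup>2 \<and> real (card G) / 2 \<le> cmod (exp_sum Q \<psi> b x t)"
          using T by (intro exI[of _ "real j * T"]) auto
      qed simp
      ultimately show "maximal_Lp p Q \<psi> b \<ge> real ((Q div m) ^ CARD('d)) / 2 *
         (real (J * m ^ CARD('d)) * (1 / (6 * real CARD('d))) ^ CARD('d)) powr (1 / p)"
        using G by (simp add: \<delta>_def d_def)
    qed
  qed
qed

section \<open>Choice of the scale and the exponents\<close>

lemma ex_floor_root:
  fixes Q k :: nat
  assumes "k \<ge> 1"
  obtains m where "m ^ k \<le> Q" "Q < Suc m ^ k"
proof -
  have "\<exists>m. Q < Suc m ^ k"
    using self_le_power[of "Suc Q" k] assms by (intro exI[of _ Q]) (simp add: Suc_le_eq)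
  then have *: "Q < Suc (LEAST m. Q < Suc m ^ k) ^ k" by (rule LeastI_ex)
  moreover have "(LEAST m. Q < Suc m ^ k) ^ k \<le> Q"
  proof (cases "LEAST m. Q < Suc m ^ k")
    case (Suc n)
    then have "\<not> Q < Suc n ^ k" using not_less_Least[of n "\<lambda>m. Q < Suc m ^ k"] by simp
    then show ?thesis using Suc by simp
  qed (use assms in \<open>auto simp: power_0_left\<close>)
  ultimately show ?thesis using that by blast
qed

text \<open>
  The number \<open>m\<close> is the integer part of the \<open>(d + 2)\<close>-th root of \<open>Q\<close>, and \<open>J\<close> is the integer part
  of \<open>\<epsilon> * m\<^sup>2 / 120\<close>.  For large \<open>Q\<close> the latter is at least 1, hence at least half of the number
  rounded; this is where the constant 240 comes from.
\<close>

lemma scale_parameters: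
  fixes \<epsilon> :: real and d :: nat
  assumes \<epsilon>: "0 < \<epsilon>" "\<epsilon> \<le> 1" and d: "d \<ge> 1"
  obtains Q0 :: nat where "Q0 \<ge> 1"
    "\<And>Q. Q \<ge> Q0 \<Longrightarrow> \<exists>m J. 1 \<le> m \<and> m ^ (d + 2) \<le> Q \<and> Q < (2 * m) ^ (d + 2) \<and> J * m \<le> Q \<and>
       real J * 120 \<le> \<epsilon> * (real m)\<^sup>2 \<and> \<epsilon> / 240 * (real m)\<^sup>2 \<le> real J"
proof -
  obtain M :: nat where M: "120 / \<epsilon> \<le> real M" using real_arch_simple by blast
  have "120 / \<epsilon> > 0" using \<epsilon> by simp
  then have M1: "M \<ge> 1" using M by linarith
  show ?thesis
  proof
    show "1 \<le> M ^ (d + 2)" using M1 by (rule one_le_power)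
    fix Q assume Q: "M ^ (d + 2) \<le> Q"
    obtain m where m: "m ^ (d + 2) \<le> Q" "Q < Suc m ^ (d + 2)"
      using ex_floor_root[of "d + 2" Q] by auto
    have "M ^ (d + 2) < Suc m ^ (d + 2)" using Q m(2) by linarith
    then have mM: "M \<le> m" using power_less_imp_less_base[of M "d + 2" "Suc m"] by simp
    then have m1: "1 \<le> m" using M1 by simp
    define J where "J = nat \<lfloor>\<epsilon> * (real m)\<^sup>2 / 120\<rfloor>"
    have "120 \<le> \<epsilon> * real M" using M \<epsilon> by (simp add: field_simps)
    also have "\<dots> \<le> \<epsilon> * real m" using mM \<epsilon> by simp
    also have "\<dots> \<le> \<epsilon> * (real m)\<^sup>2" using m1 \<epsilon> by (simp add: power2_eq_square)
    finally have big: "1 \<le> \<epsilon> * (real m)\<^sup>2 / 120" by simp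
    then have J: "real J \<le> \<epsilon> * (real m)\<^sup>2 / 120" "\<epsilon> * (real m)\<^sup>2 / 120 \<le> real J + 1" "real J \<ge> 1"
    proof -
      have "real J = of_int \<lfloor>\<epsilon> * (real m)\<^sup>2 / 120\<rfloor>" using \<epsilon> by (simp add: J_def)
      moreover have "1 \<le> \<lfloor>\<epsilon> * (real m)\<^sup>2 / 120\<rfloor>" using big by (simp only: le_floor_iff)
      ultimately show "real J \<le> \<epsilon> * (real m)\<^sup>2 / 120" "\<epsilon> * (real m)\<^sup>2 / 120 \<le> real J + 1" "real J \<ge> 1"
        by linarith+
    qed
    have "\<epsilon> * (real m)\<^sup>2 \<le> 1 * (real m)\<^sup>2" using \<epsilon> by (intro mult_right_mono) auto
    moreover have "0 \<le> (real m)\<^sup>2" by simp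
    ultimately have "real J \<le> (real m)\<^sup>2" using J(1) by linarith
    then have "J \<le> m ^ 2" by (metis of_nat_le_iff of_nat_power)
    then have "J * m \<le> m ^ 2 * m" by simp
    also have "\<dots> = m ^ 3" by (simp add: power2_eq_square power3_eq_cube)
    also have "\<dots> \<le> m ^ (d + 2)" using m1 d by (intro power_increasing) auto
    also have "\<dots> \<le> Q" by (rule m(1))
    finally have "J * m \<le> Q" .
    moreover have "Suc m ^ (d + 2) \<le> (2 * m) ^ (d + 2)" using m1 by (intro power_mono) auto
    moreover have "\<epsilon> / 240 * (real m)\<^sup>2 \<le> real J" using J by linarith
    ultimately show "\<exists>m J. 1 \<le> m \<and> m ^ (d + 2) \<le> Q \<and> Q < (2 * m) ^ (d + 2) \<and> J * m \<le> Q \<and>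
       real J * 120 \<le> \<epsilon> * (real m)\<^sup>2 \<and> \<epsilon> / 240 * (real m)\<^sup>2 \<le> real J"
      using m m1 J by (intro exI[of _ m] exI[of _ J]) auto
  qed
qed

text \<open>The right-hand side is the l2 norm of the indicator of the sparse grid.\<close>

lemma sqrt_count_ge:
  fixes m Q d :: nat
  assumes m: "1 \<le> m" "m ^ (d + 2) \<le> Q"
  shows "(1 / 2) powr (real d / 2) * real Q powr (real d * (real d + 1) / (2 * (real d + 2)))
    \<le> sqrt (real ((Q div m) ^ d))"
proof -
  have "1 \<le> m ^ (d + 2)" using m by (simp add: one_le_power)
  then have Q: "Q \<ge> 1" using m by linarith
  define s where "s = real Q powr (1 / (real d + 2))"
  have s: "s > 0" using Q by (simp add: s_def)
  have "real m powr (real d + 2) \<le> real Q"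
  proof -
    have "real m powr (real d + 2) = real m powr real (d + 2)" by (simp add: add.commute)
    also have "\<dots> = real (m ^ (d + 2))" using m by (subst powr_realpow) auto
    finally show ?thesis using m(2) by linarith
  qed
  then have "(real m powr (real d + 2)) powr (1 / (real d + 2)) \<le> s"
    unfolding s_def by (intro powr_mono2) auto
  then have ms: "real m \<le> s" using m by (simp add: powr_powr)
  have "m \<le> m ^ (d + 2)" using m by (intro self_le_power) auto
  then have mQ: "m \<le> Q" using m by linarith
  have "Q < m * (Q div m + 1)" using m dividend_less_times_div[of m Q] by simp
  also have "\<dots> \<le> m * (2 * (Q div m))"
    using m mQ by (intro mult_left_mono) (auto simp: Suc_le_eq div_greater_zero_iff)
  finally have "real Q \<le> real (m * (2 * (Q div m)))" by linarith
  then have "real Q / (2 * real m) \<le> real (Q div m)" using m by (simp add: field_simps)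
  moreover have "real Q / (2 * s) \<le> real Q / (2 * real m)"
    using ms m s by (intro divide_left_mono) auto
  ultimately have "1 / 2 * (real Q / s) \<le> real (Q div m)" by simp
  moreover have "real Q / s = real Q powr ((real d + 1) / (real d + 2))"
  proof -
    have "real Q / s = real Q powr (1 - 1 / (real d + 2))"
      using Q by (simp add: s_def powr_diff)
    also have "1 - 1 / (real d + 2) = (real d + 1) / (real d + 2)" by (simp add: field_simps)
    finally show ?thesis .
  qed
  ultimately have "(1 / 2 * real Q powr ((real d + 1) / (real d + 2))) powr (real d / 2)
      \<le> real (Q div m) powr (real d / 2)"
    by (intro powr_mono2) auto
  also have "\<dots> = sqrt (real ((Q div m) ^ d))"
    using m mQ by (simp add: powr_half_sqrt[symmetric] powr_realpow[symmetric] powr_powr div_greater_zero_iff)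
  also have "(1 / 2 * real Q powr ((real d + 1) / (real d + 2))) powr (real d / 2)
    = (1 / 2) powr (real d / 2) * real Q powr (real d * (real d + 1) / (2 * (real d + 2)))"
    unfolding powr_mult powr_powr by (simp add: mult_ac)
  finally show ?thesis .
qed

text \<open>The right-hand side is the total volume of the focusing cubes when their side is \<open>\<delta>\<close>.\<close>

lemma focus_volume_ge:
  fixes m Q d J :: nat
  assumes Q: "Q < (2 * m) ^ (d + 2)" and J: "\<epsilon> / 240 * (real m)\<^sup>2 \<le> real J"
    and \<epsilon>: "0 < \<epsilon>" and \<delta>: "0 < \<delta>"
  shows "\<epsilon> / 240 * \<delta> ^ d / 2 ^ (d + 2) * real Q \<le> real (J * m ^ d) * \<delta> ^ d"
proof -
  have "real Q \<le> real ((2 * m) ^ (d + 2))" using Q by linarith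
  then have "real Q / 2 ^ (d + 2) \<le> (real m)\<^sup>2 * real m ^ d"
    by (simp add: power_mult_distrib field_simps power_add power2_eq_square)
  then have "\<epsilon> / 240 * (real Q / 2 ^ (d + 2)) \<le> \<epsilon> / 240 * ((real m)\<^sup>2 * real m ^ d)"
    using \<epsilon> by (intro mult_left_mono) auto
  also have "\<dots> = \<epsilon> / 240 * (real m)\<^sup>2 * real m ^ d" by simp
  also have "\<dots> \<le> real J * real m ^ d" using J by (intro mult_right_mono) auto
  finally have "\<epsilon> / 240 * (real Q / 2 ^ (d + 2)) * \<delta> ^ d \<le> real J * real m ^ d * \<delta> ^ d"
    using \<delta> by (intro mult_right_mono) auto
  then show ?thesis by (simp add: mult_ac)
qed

text \<open>A constant in (0, 1] is not decreased by raising it to the power 1/p, which makes the bounds uniform in \<open>p\<close>.\<close>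

lemma powr_inverse_ge:
  fixes x y \<kappa> :: real
  assumes "p \<ge> 1" "0 < \<kappa>" "\<kappa> \<le> 1" "0 \<le> y" "\<kappa> * y \<le> x"
  shows "\<kappa> * y powr (1 / p) \<le> x powr (1 / p)"
proof -
  have "\<kappa> powr 1 \<le> \<kappa> powr (1 / p)" using assms by (intro powr_mono') auto
  then have "\<kappa> * y powr (1 / p) \<le> \<kappa> powr (1 / p) * y powr (1 / p)"
    using assms by (intro mult_right_mono) auto
  also have "\<dots> = (\<kappa> * y) powr (1 / p)" using assms by (simp add: powr_mult)
  also have "\<dots> \<le> x powr (1 / p)" using assms by (intro powr_mono2) auto
  finally show ?thesis .
qed

lemma p_crit_exponent:
  assumes "d \<ge> 1"
  shows "p_crit d \<ge> 1"
    "real d * (real d + 1) / (2 * (real d + 2)) + 1 / p_crit d = real d / 2"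
proof -
  show "p_crit d \<ge> 1" using assms by (simp add: p_crit_def field_simps)
  have *: "x * (x + 1) / (2 * (x + 2)) + 1 / (2 * (x + 2) / x) = x / 2" if "x > 0" for x :: real
  proof -
    have "x + 2 \<noteq> 0" using that by auto
    then show ?thesis using that by (simp add: divide_simps) algebra
  qed
  show "real d * (real d + 1) / (2 * (real d + 2)) + 1 / p_crit d = real d / 2"
    unfolding p_crit_def by (rule *) (use assms in simp)
qed

lemma p_con_exponent:
  assumes "d \<ge> 1"
  shows "p_con d \<ge> 1"
    "real d * (real d + 1) / (2 * (real d + 2)) + 1 / p_con d
      = real d / 2 + real d / (2 * (real d + 1) * (real d + 2))"
proof -
  show "p_con d \<ge> 1" using assms by (simp add: p_con_def field_simps)
  have *: "x * (x + 1) / (2 * (x + 2)) + 1 / (2 * (x + 1) / x) = x / 2 + x / (2 * (x + 1) * (x + 2))"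
    if "x > 0" for x :: real
  proof -
    have "x + 1 \<noteq> 0" "x + 2 \<noteq> 0" using that by auto
    then show ?thesis using that by (simp add: divide_simps) algebra
  qed
  show "real d * (real d + 1) / (2 * (real d + 2)) + 1 / p_con d
      = real d / 2 + real d / (2 * (real d + 1) * (real d + 2))"
    unfolding p_con_def by (rule *) (use assms in simp)
qed

theorem theorem1p2:
  fixes A :: real
  defines "d \<equiv> real CARD('d::finite)"
  assumes "A > 0"
  shows "\<forall>\<epsilon>>0. \<exists>Q0\<ge>1. \<exists>c0>0.
    \<forall>\<phi> :: real ^ 'd \<Rightarrow> real. C2_on unit_cube \<phi> \<and> C2_norm \<phi> \<le> A \<longrightarrow>
      (\<forall>Q\<ge>Q0. \<exists>(\<psi> :: real ^ 'd \<Rightarrow> real) (b :: nat ^ 'd \<Rightarrow> complex).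
         C2_on unit_cube \<psi> \<and> C2_norm (\<lambda>\<xi>. \<phi> \<xi> - \<psi> \<xi>) \<le> \<epsilon> \<and>
         (\<exists>q\<in>grid Q. b q \<noteq> 0) \<and>
         (\<forall>p\<ge>1. maximal_Lp p Q \<psi> b
            \<ge> c0 * real Q powr (d * (d + 1) / (2 * (d + 2)) + 1 / p) * l2_norm Q b) \<and>
         maximal_Lp (p_crit CARD('d)) Q \<psi> b \<ge> c0 * real Q powr (d / 2) * l2_norm Q b \<and>
         maximal_Lp (p_con CARD('d)) Q \<psi> b
            \<ge> c0 * real Q powr (d / 2 + d / (2 * (d + 1) * (d + 2))) * l2_norm Q b)"
proof (intro allI impI)
  fix \<epsilon>' :: real assume "\<epsilon>' > 0"
  define \<epsilon> where "\<epsilon> = min \<epsilon>' 1"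
  have \<epsilon>: "0 < \<epsilon>" "\<epsilon> \<le> 1" "\<epsilon> \<le> \<epsilon>'" using \<open>\<epsilon>' > 0\<close> by (auto simp: \<epsilon>_def)
  define n where "n = CARD('d)"
  have n: "n \<ge> 1" by (simp add: n_def Suc_le_eq)
  have dn: "d = real n" by (simp add: d_def n_def)
  define \<delta> where "\<delta> = 1 / (6 * d)"
  have \<delta>: "0 < \<delta>" "\<delta> \<le> 1" using n by (auto simp: \<delta>_def dn field_simps)
  have \<delta>_n: "\<delta> = 1 / (6 * real n)" by (simp add: \<delta>_def dn)
  define \<kappa> where "\<kappa> = \<epsilon> / 240 * \<delta> ^ n / 2 ^ (n + 2)"
  define c0 where "c0 = (1 / 2) powr (d / 2) / 2 * \<kappa>"
  have \<kappa>0: "0 < \<kappa>" using \<epsilon> \<delta> by (simp add: \<kappa>_def)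
  have \<kappa>1: "\<kappa> \<le> 1"
  proof -
    have "\<epsilon> / 240 * \<delta> ^ n \<le> 1 * 1" using \<epsilon> \<delta> by (intro mult_mono) (auto intro: power_le_one)
    also have "\<dots> \<le> 2 ^ (n + 2)" using one_le_power[of "2 :: real" "n + 2"] by simp
    finally show ?thesis by (simp add: \<kappa>_def)
  qed
  have c0: "c0 > 0" using \<kappa>0 by (simp add: c0_def)
  obtain Q0 :: nat where Q0: "Q0 \<ge> 1"
    "\<And>Q. Q \<ge> Q0 \<Longrightarrow> \<exists>m J. 1 \<le> m \<and> m ^ (n + 2) \<le> Q \<and> Q < (2 * m) ^ (n + 2) \<and> J * m \<le> Q \<and>
       real J * 120 \<le> \<epsilon> * (real m)\<^sup>2 \<and> \<epsilon> / 240 * (real m)\<^sup>2 \<le> real J"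
    using scale_parameters[OF \<epsilon>(1,2) n] by blast
  have "\<exists>(\<psi> :: real ^ 'd \<Rightarrow> real) (b :: nat ^ 'd \<Rightarrow> complex).
         C2_on unit_cube \<psi> \<and> C2_norm (\<lambda>\<xi>. \<phi> \<xi> - \<psi> \<xi>) \<le> \<epsilon>' \<and>
         (\<exists>q\<in>grid Q. b q \<noteq> 0) \<and>
         (\<forall>p\<ge>1. maximal_Lp p Q \<psi> b
            \<ge> c0 * real Q powr (d * (d + 1) / (2 * (d + 2)) + 1 / p) * l2_norm Q b) \<and>
         maximal_Lp (p_crit CARD('d)) Q \<psi> b \<ge> c0 * real Q powr (d / 2) * l2_norm Q b \<and>
         maximal_Lp (p_con CARD('d)) Q \<psi> b
            \<ge> c0 * real Q powr (d / 2 + d / (2 * (d + 1) * (d + 2))) * l2_norm Q b"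
    if \<phi>: "C2_on unit_cube \<phi>" and Q: "Q \<ge> Q0" for \<phi> :: "real ^ 'd \<Rightarrow> real" and Q
  proof -
    obtain m J where m: "1 \<le> m" "m ^ (n + 2) \<le> Q" "Q < (2 * m) ^ (n + 2)"
      and J: "J * m \<le> Q" "real J * 120 \<le> \<epsilon> * (real m)\<^sup>2" "\<epsilon> / 240 * (real m)\<^sup>2 \<le> real J"
      using Q0(2)[OF Q] by blast
    have "m \<le> m ^ (n + 2)" using m by (intro self_le_power) auto
    then have mQ: "m \<le> Q" using m by linarith
    obtain \<psi> :: "real ^ 'd \<Rightarrow> real" and b :: "nat ^ 'd \<Rightarrow> complex"
      where \<psi>: "C2_on unit_cube \<psi>" "C2_norm (\<lambda>\<xi>. \<phi> \<xi> - \<psi> \<xi>) \<le> \<epsilon>" "\<exists>q\<in>grid Q. b q \<noteq> 0"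
        and l2: "l2_norm Q b = sqrt (real ((Q div m) ^ n))"
        and large: "\<forall>p\<ge>1. maximal_Lp p Q \<psi> b \<ge> real ((Q div m) ^ n) / 2 *
          (real (J * m ^ n) * \<delta> ^ n) powr (1 / p)"
      by (rule focusing_at_scale[OF \<phi> \<epsilon>(1) m(1) mQ J(1,2), folded n_def, folded \<delta>_n])
    have all_p: "maximal_Lp p Q \<psi> b
            \<ge> c0 * real Q powr (d * (d + 1) / (2 * (d + 2)) + 1 / p) * l2_norm Q b" if p: "p \<ge> 1" for p
    proof -
      have vol: "\<kappa> * real Q powr (1 / p) \<le> (real (J * m ^ n) * \<delta> ^ n) powr (1 / p)"
        using focus_volume_ge[OF m(3) J(3) \<epsilon>(1) \<delta>(1)]
        by (intro powr_inverse_ge p \<kappa>0 \<kappa>1) (auto simp: \<kappa>_def)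
      have amp: "(1 / 2) powr (d / 2) * real Q powr (d * (d + 1) / (2 * (d + 2))) \<le> l2_norm Q b"
        unfolding l2 dn by (rule sqrt_count_ge[OF m(1,2)])
      have l20: "l2_norm Q b \<ge> 0" by (simp add: l2)
      \<comment> \<open>The number of frequencies is the square of the l2 norm; one factor is bounded by \<open>amp\<close>.\<close>
      have "c0 * real Q powr (d * (d + 1) / (2 * (d + 2)) + 1 / p) * l2_norm Q b
        = ((1 / 2) powr (d / 2) * real Q powr (d * (d + 1) / (2 * (d + 2)))) * l2_norm Q b / 2
          * (\<kappa> * real Q powr (1 / p))"
        by (simp add: c0_def powr_add)
      also have "\<dots> \<le> l2_norm Q b * l2_norm Q b / 2 * (real (J * m ^ n) * \<delta> ^ n) powr (1 / p)"
        using \<kappa>0 by (intro mult_mono divide_right_mono vol amp l20 mult_nonneg_nonneg order_refl) auto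
      also have "l2_norm Q b * l2_norm Q b = real ((Q div m) ^ n)" by (simp add: l2)
      also have "\<dots> / 2 * (real (J * m ^ n) * \<delta> ^ n) powr (1 / p) \<le> maximal_Lp p Q \<psi> b"
        using large p by blast
      finally show ?thesis .
    qed
    have "C2_norm (\<lambda>\<xi>. \<phi> \<xi> - \<psi> \<xi>) \<le> \<epsilon>'" using \<psi>(2) \<epsilon>(3) by simp
    moreover note all_p[OF p_crit_exponent(1)[OF n], folded n_def, unfolded dn p_crit_exponent(2)[OF n]]
      all_p[OF p_con_exponent(1)[OF n], folded n_def, unfolded dn p_con_exponent(2)[OF n]]
    ultimately show ?thesis
      using \<psi>(1,3) all_p unfolding dn n_def by blast
  qed
  then show "\<exists>Q0\<ge>1. \<exists>c0>0.
    \<forall>\<phi> :: real ^ 'd \<Rightarrow> real. C2_on unit_cube \<phi> \<and> C2_norm \<phi> \<le> A \<longrightarrow>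
      (\<forall>Q\<ge>Q0. \<exists>(\<psi> :: real ^ 'd \<Rightarrow> real) (b :: nat ^ 'd \<Rightarrow> complex).
         C2_on unit_cube \<psi> \<and> C2_norm (\<lambda>\<xi>. \<phi> \<xi> - \<psi> \<xi>) \<le> \<epsilon>' \<and>
         (\<exists>q\<in>grid Q. b q \<noteq> 0) \<and>
         (\<forall>p\<ge>1. maximal_Lp p Q \<psi> b
            \<ge> c0 * real Q powr (d * (d + 1) / (2 * (d + 2)) + 1 / p) * l2_norm Q b) \<and>
         maximal_Lp (p_crit CARD('d)) Q \<psi> b \<ge> c0 * real Q powr (d / 2) * l2_norm Q b \<and>
         maximal_Lp (p_con CARD('d)) Q \<psi> b
            \<ge> c0 * real Q powr (d / 2 + d / (2 * (d + 1) * (d + 2))) * l2_norm Q b)"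
    using Q0(1) c0 by blast
qed

end
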